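(* A connected bipartite graph $G$ is $2$-$\gamma_{\rm MB}'$-critical if and only if either $G$ is isomorphic to $K_{2,m}$ for some $m\ge 3$, or $G$ is isomorphic to $B_{n,m}$ for some $n,m\ge 3$.
   Context: For $n,m\ge 3$, $B_{n,m}$ is the (unique up to isomorphism) bipartite graph with bipartition $V_1,V_2$, $|V_1|=n$, $|V_2|=m$, in which $V_1$ contains exactly two vertices of degree $m$, $V_2$ contains exactly two vertices of degree $n$, and all other vertices have degree $2$. The Maker-Breaker domination (MBD) game on a graph $G$ is played by Dominator and Staller, who alternately select previously unselected vertices of $G$. Dominator wins if the set of vertices he has selected becomes a dominating set of $G$; Staller wins if she has selected at least one vertex of every dominating set of $G$. In the S-game Staller moves first. $\gamma_{\rm MB}'(G)$ is the minimum number $k$ such that Dominator has a strategy in the S-game guaranteeing that he wins having made at most $k$ moves, whatever Staller does; $\gamma_{\rm MB}'(G)=\infty$ if Dominator has no winning strategy in the S-game. A graph $G$ is $k$-$\gamma_{\rm MB}'$-critical if $\gamma_{\rm MB}'(G)=k$ and $\gamma_{\rm MB}'(G)<\gamma_{\rm MB}'(G-e)$ for every $e\in E(G)$. *)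

theory Defs
  imports "Graph_Theory.Graph_Theory" "HOL-Library.Extended_Nat"
begin

text \<open>
  Finite simple graphs are symmetric, loop-free, finite digraphs without parallel arcs
  (locale \<^locale>\<open>pair_graph\<close>). An undirected edge \<open>uv\<close> is the pair of arcs
  \<open>(u,v)\<close>, \<open>(v,u)\<close>, so the degree of a vertex is its \<^const>\<open>out_degree\<close>.
\<close>

definition del_edge :: "'a pair_pre_digraph \<Rightarrow> 'a \<Rightarrow> 'a \<Rightarrow> 'a pair_pre_digraph" where
  "del_edge G u v = G\<lparr>parcs := parcs G - {(u, v), (v, u)}\<rparr>"

definition bipartition :: "'a pair_pre_digraph \<Rightarrow> 'a set \<Rightarrow> 'a set \<Rightarrow> bool" where
  "bipartition G V1 V2 \<longleftrightarrow>
     V1 \<union> V2 = pverts G \<and> V1 \<inter> V2 = {} \<and> parcs G \<subseteq> V1 \<times> V2 \<union> V2 \<times> V1"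

definition bipartite :: "'a pair_pre_digraph \<Rightarrow> bool" where
  "bipartite G \<longleftrightarrow> (\<exists>V1 V2. bipartition G V1 V2)"

definition dominating_set :: "'a pair_pre_digraph \<Rightarrow> 'a set \<Rightarrow> bool" where
  "dominating_set G D \<longleftrightarrow>
     D \<subseteq> pverts G \<and> (\<forall>v \<in> pverts G. v \<in> D \<or> (\<exists>u \<in> D. (u, v) \<in> parcs G))"


section \<open>The S-game\<close>

text \<open>
  A position is the list of the vertices selected so far, oldest first. Staller starts, hence
  her moves are at the even indices, and it is her turn iff the list has even length.
\<close>

definition staller_moves :: "'a list \<Rightarrow> 'a list" where
  "staller_moves p = nths p {i. even i}"

definition dominator_moves :: "'a list \<Rightarrow> 'a list" where
  "dominator_moves p = nths p {i. odd i}"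

definition dominator_won :: "'a pair_pre_digraph \<Rightarrow> 'a list \<Rightarrow> bool" where
  "dominator_won G p \<longleftrightarrow> dominating_set G (set (dominator_moves p))"

definition staller_won :: "'a pair_pre_digraph \<Rightarrow> 'a list \<Rightarrow> bool" where
  "staller_won G p \<longleftrightarrow> (\<forall>D. dominating_set G D \<longrightarrow> D \<inter> set (staller_moves p) \<noteq> {})"

definition game_over :: "'a pair_pre_digraph \<Rightarrow> 'a list \<Rightarrow> bool" where
  "game_over G p \<longleftrightarrow> dominator_won G p \<or> staller_won G p"

text \<open>
  A strategy \<open>\<sigma>\<close> of Dominator maps each position in which he is to move to the vertex he
  selects. The positions that can arise when he follows \<open>\<sigma>\<close> and Staller plays arbitrarily:
\<close>

inductive s_game_position :: "'a pair_pre_digraph \<Rightarrow> ('a list \<Rightarrow> 'a) \<Rightarrow> 'a list \<Rightarrow> bool"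
  for G \<sigma> where
  start: "s_game_position G \<sigma> []"
| staller: "\<lbrakk>s_game_position G \<sigma> p; even (length p); \<not> game_over G p; v \<in> pverts G - set p\<rbrakk>
    \<Longrightarrow> s_game_position G \<sigma> (p @ [v])"
| dominator: "\<lbrakk>s_game_position G \<sigma> p; odd (length p); \<not> game_over G p\<rbrakk>
    \<Longrightarrow> s_game_position G \<sigma> (p @ [\<sigma> p])"

definition legal_strategy :: "'a pair_pre_digraph \<Rightarrow> ('a list \<Rightarrow> 'a) \<Rightarrow> bool" where
  "legal_strategy G \<sigma> \<longleftrightarrow>
     (\<forall>p. s_game_position G \<sigma> p \<and> odd (length p) \<and> \<not> game_over G p \<longrightarrow> \<sigma> p \<in> pverts G - set p)"

text \<open>
  Positions never repeat a vertex, and once every vertex is selected one of the players has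
  won (\<open>all_selected_game_over\<close> below). So on a finite graph every play reaches a
  position in which the game is over, and it suffices to constrain these positions.
\<close>

definition wins_within :: "'a pair_pre_digraph \<Rightarrow> nat \<Rightarrow> ('a list \<Rightarrow> 'a) \<Rightarrow> bool" where
  "wins_within G k \<sigma> \<longleftrightarrow> legal_strategy G \<sigma> \<and>
     (\<forall>p. s_game_position G \<sigma> p \<and> game_over G p \<longrightarrow>
          dominator_won G p \<and> length (dominator_moves p) \<le> k)"

text \<open>The infimum of the empty set is \<open>\<infinity>\<close> in \<^typ>\<open>enat\<close>.\<close>

definition gamma_MB' :: "'a pair_pre_digraph \<Rightarrow> enat" where
  "gamma_MB' G = Inf {enat k | k. \<exists>\<sigma>. wins_within G k \<sigma>}"

definition gamma_MB'_critical :: "nat \<Rightarrow> 'a pair_pre_digraph \<Rightarrow> bool" where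
  "gamma_MB'_critical k G \<longleftrightarrow>
     gamma_MB' G = enat k \<and> (\<forall>(u, v) \<in> parcs G. gamma_MB' G < gamma_MB' (del_edge G u v))"

lemma game_overI:
  assumes "set (staller_moves p) \<union> set (dominator_moves p) = pverts G"
  shows "game_over G p"
proof (rule ccontr)
  assume "\<not> game_over G p"
  then have nd: "\<not> dominating_set G (set (dominator_moves p))"
    and ns: "\<not> staller_won G p" by (auto simp: game_over_def dominator_won_def)
  from ns obtain D where D: "dominating_set G D" "D \<inter> set (staller_moves p) = {}"
    by (auto simp: staller_won_def)
  then have "D \<subseteq> set (dominator_moves p)" using assms by (auto simp: dominating_set_def)
  then have "dominating_set G (set (dominator_moves p))"
    using D assms by (fastforce simp: dominating_set_def)
  with nd show False by simp
qed

lemma all_selected_game_over: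
  assumes "set p = pverts G"
  shows "game_over G p"
proof -
  have "set (staller_moves p) \<union> set (dominator_moves p) = set p"
    unfolding staller_moves_def dominator_moves_def set_nths
    by (subst set_conv_nth) blast
  then show ?thesis using assms by (simp add: game_overI)
qed


section \<open>The graphs \<open>K\<^bsub>n,m\<^esub>\<close> and \<open>B\<^bsub>n,m\<^esub>\<close>\<close>

definition K_graph :: "nat \<Rightarrow> nat \<Rightarrow> (nat + nat) pair_pre_digraph" where
  "K_graph n m = \<lparr>pverts = {..<n} <+> {..<m},
     parcs = Inl ` {..<n} \<times> Inr ` {..<m} \<union> Inr ` {..<m} \<times> Inl ` {..<n}\<rparr>"

text \<open>
  \<open>is_B\<close> is the property defining \<open>B\<^bsub>n,m\<^esub>\<close>, and \<open>B_graph\<close> is a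
  representative: for \<open>n, m \<ge> 3\<close> it has the property (\<open>is_B_B_graph\<close>), and every graph with
  the property is isomorphic to it (\<open>is_B_imp_isomorphic\<close>).
\<close>

definition is_B :: "nat \<Rightarrow> nat \<Rightarrow> 'a pair_pre_digraph \<Rightarrow> bool" where
  "is_B n m G \<longleftrightarrow> pair_graph G \<and> (\<exists>V1 V2. bipartition G V1 V2 \<and> card V1 = n \<and> card V2 = m \<and>
     card {v \<in> V1. out_degree (with_proj G) v = m} = 2 \<and>
     card {v \<in> V2. out_degree (with_proj G) v = n} = 2 \<and>
     (\<forall>v \<in> V1. out_degree (with_proj G) v \<noteq> m \<longrightarrow> out_degree (with_proj G) v = 2) \<and>
     (\<forall>v \<in> V2. out_degree (with_proj G) v \<noteq> n \<longrightarrow> out_degree (with_proj G) v = 2))"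

definition B_graph :: "nat \<Rightarrow> nat \<Rightarrow> (nat + nat) pair_pre_digraph" where
  "B_graph n m = \<lparr>pverts = {..<n} <+> {..<m},
     parcs = {(Inl i, Inr j) | i j. i < n \<and> j < m \<and> (i < 2 \<or> j < 2)}
           \<union> {(Inr j, Inl i) | i j. i < n \<and> j < m \<and> (i < 2 \<or> j < 2)}\<rparr>"

definition isomorphic :: "'a pair_pre_digraph \<Rightarrow> 'b pair_pre_digraph \<Rightarrow> bool" where
  "isomorphic G H \<longleftrightarrow> digraph_iso (with_proj G) (with_proj H)"

lemma isomorphic_iff:
  assumes G: "pair_wf_digraph G" and H: "pair_wf_digraph H"
  shows "isomorphic G H \<longleftrightarrow> (\<exists>f. bij_betw f (pverts G) (pverts H) \<and>
    (\<forall>u \<in> pverts G. \<forall>v \<in> pverts G. (u, v) \<in> parcs G \<longleftrightarrow> (f u, f v) \<in> parcs H))"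
    (is "?L \<longleftrightarrow> ?R")
proof
  interpret G: pair_wf_digraph G by fact
  assume ?L
  then obtain h where iso: "pre_digraph.digraph_isomorphism (with_proj G) h"
    and app: "with_proj H = app_iso h (with_proj G)"
    by (auto simp: isomorphic_def digraph_iso_def)
  let ?f = "iso_verts h"
  from app have v: "pverts H = ?f ` pverts G" and a: "parcs H = iso_arcs h ` parcs G"
    and t: "iso_tail h = fst" and hd: "iso_head h = snd"
    by (simp_all add: app_iso_def with_proj_def)
  from iso have inj: "inj_on ?f (pverts G)"
    and e: "\<And>e. e \<in> parcs G \<Longrightarrow> iso_arcs h e = (?f (fst e), ?f (snd e))"
    unfolding pre_digraph.digraph_isomorphism_def t hd by (simp_all add: prod_eq_iff)
  have "bij_betw ?f (pverts G) (pverts H)" using inj v by (simp add: bij_betw_def)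
  moreover have "(x, y) \<in> parcs G \<longleftrightarrow> (?f x, ?f y) \<in> parcs H"
    if xy: "x \<in> pverts G" "y \<in> pverts G" for x y
  proof
    assume "(x, y) \<in> parcs G"
    then show "(?f x, ?f y) \<in> parcs H" using e[of "(x, y)"] a by force
  next
    assume "(?f x, ?f y) \<in> parcs H"
    then obtain u w where uw: "(u, w) \<in> parcs G" "(?f x, ?f y) = iso_arcs h (u, w)"
      using a by auto
    then have "?f x = ?f u" "?f y = ?f w" using e[OF uw(1)] by auto
    then have "x = u" "y = w"
      using inj_onD[OF inj] xy G.in_arcsD1[OF uw(1)] G.in_arcsD2[OF uw(1)] by blast+
    with uw(1) show "(x, y) \<in> parcs G" by simp
  qed
  ultimately show ?R by blast
next
  interpret G: pair_wf_digraph G by fact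
  interpret H: pair_wf_digraph H by fact
  assume ?R
  then obtain f where f: "bij_betw f (pverts G) (pverts H)"
    and adj: "\<And>u v. u \<in> pverts G \<Longrightarrow> v \<in> pverts G \<Longrightarrow> (u, v) \<in> parcs G \<longleftrightarrow> (f u, f v) \<in> parcs H"
    by blast
  let ?h = "\<lparr>iso_verts = f, iso_arcs = map_prod f f, iso_head = snd, iso_tail = fst\<rparr>"
  from f have inj: "inj_on f (pverts G)" and im: "f ` pverts G = pverts H"
    by (auto simp: bij_betw_def)
  have "inj_on (map_prod f f) (parcs G)"
  proof (rule inj_onI)
    fix e e' assume "e \<in> parcs G" "e' \<in> parcs G" "map_prod f f e = map_prod f f e'"
    then show "e = e'"
      using inj_onD[OF inj] G.arc_fst_in_verts G.arc_snd_in_verts by (simp add: prod_eq_iff)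
  qed
  then have "pre_digraph.digraph_isomorphism (with_proj G) ?h"
    using inj G.wf_digraph by (simp add: pre_digraph.digraph_isomorphism_def)
  moreover have "map_prod f f ` parcs G = parcs H"
  proof (intro equalityI subsetI)
    fix e assume "e \<in> map_prod f f ` parcs G"
    then obtain u w where uw: "(u, w) \<in> parcs G" "e = (f u, f w)" by auto
    then show "e \<in> parcs H"
      using adj[OF G.in_arcsD1[OF uw(1)] G.in_arcsD2[OF uw(1)]] by simp
  next
    fix e assume e: "e \<in> parcs H"
    obtain a b where ab: "e = (a, b)" by (cases e)
    with e have "a \<in> pverts H" "b \<in> pverts H" using H.in_arcsD1 H.in_arcsD2 by blast+
    then obtain u w where uw: "u \<in> pverts G" "w \<in> pverts G" "a = f u" "b = f w"
      using im by blast
    with adj e ab have "(u, w) \<in> parcs G" by simp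
    with uw ab show "e \<in> map_prod f f ` parcs G" by force
  qed
  then have "with_proj H = app_iso ?h (with_proj G)"
    using im by (simp add: app_iso_def with_proj_def)
  ultimately show ?L by (auto simp: isomorphic_def digraph_iso_def)
qed

lemma pair_graph_K_graph: "pair_graph (K_graph n m)"
  by unfold_locales (auto simp: K_graph_def symmetric_def sym_def)

lemma pair_graph_B_graph: "pair_graph (B_graph n m)"
proof -
  have "finite (parcs (B_graph n m))"
    by (rule finite_subset[of _ "({..<n} <+> {..<m}) \<times> ({..<n} <+> {..<m})"])
      (auto simp: B_graph_def)
  then show ?thesis
    by unfold_locales (auto simp: B_graph_def symmetric_def sym_def)
qed

lemma is_B_B_graph:
  assumes "n \<ge> 3" "m \<ge> 3"
  shows "is_B n m (B_graph n m)"
proof -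
  let ?G = "B_graph n m"
  let ?V1 = "Inl ` {..<n} :: (nat + nat) set" and ?V2 = "Inr ` {..<m} :: (nat + nat) set"
  have d1: "out_degree (with_proj ?G) (Inl i) = (if i < 2 then m else 2)" if "i < n" for i
  proof -
    have "out_arcs (with_proj ?G) (Inl i) =
        (\<lambda>j. (Inl i, Inr j)) ` (if i < 2 then {..<m} else {..<2})"
      using that assms by (auto simp: out_arcs_def B_graph_def)
    then show ?thesis by (simp add: out_degree_def card_image inj_on_def)
  qed
  have d2: "out_degree (with_proj ?G) (Inr j) = (if j < 2 then n else 2)" if "j < m" for j
  proof -
    have "out_arcs (with_proj ?G) (Inr j) =
        (\<lambda>i. (Inr j, Inl i)) ` (if j < 2 then {..<n} else {..<2})"
      using that assms by (auto simp: out_arcs_def B_graph_def)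
    then show ?thesis by (simp add: out_degree_def card_image inj_on_def)
  qed
  have "{v \<in> ?V1. out_degree (with_proj ?G) v = m} = Inl ` {..<2}"
    using assms by (auto simp: d1 split: if_splits)
  then have c1: "card {v \<in> ?V1. out_degree (with_proj ?G) v = m} = 2"
    by (simp add: card_image)
  have "{v \<in> ?V2. out_degree (with_proj ?G) v = n} = Inr ` {..<2}"
    using assms by (auto simp: d2 split: if_splits)
  then have c2: "card {v \<in> ?V2. out_degree (with_proj ?G) v = n} = 2"
    by (simp add: card_image)
  have "bipartition ?G ?V1 ?V2" by (auto simp: bipartition_def B_graph_def)
  moreover have "card ?V1 = n" "card ?V2 = m" by (simp_all add: card_image)
  moreover have "\<forall>v \<in> ?V1. out_degree (with_proj ?G) v \<noteq> m \<longrightarrow> out_degree (with_proj ?G) v = 2"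
    "\<forall>v \<in> ?V2. out_degree (with_proj ?G) v \<noteq> n \<longrightarrow> out_degree (with_proj ?G) v = 2"
    by (simp_all add: d1 d2)
  ultimately show ?thesis using pair_graph_B_graph c1 c2 unfolding is_B_def by blast
qed

lemma full_or_two_adjacent:
  assumes "pair_graph G" "bipartition G V1 V2" "card V1 = n" "card V2 = m" "v \<in> V1" "w \<in> V2"
    and "card {w \<in> V2. out_degree (with_proj G) w = n} = 2"
    and "\<forall>v \<in> V1. out_degree (with_proj G) v \<noteq> m \<longrightarrow> out_degree (with_proj G) v = 2"
  shows "(v, w) \<in> parcs G \<longleftrightarrow>
    out_degree (with_proj G) v = m \<or> out_degree (with_proj G) w = n"
proof -
  interpret pair_graph G by fact
  have sub: "V1 \<subseteq> pverts G" "V2 \<subseteq> pverts G" and disj: "V1 \<inter> V2 = {}"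
    and arcs: "parcs G \<subseteq> V1 \<times> V2 \<union> V2 \<times> V1"
    using assms(2) by (auto simp: bipartition_def)
  have fin: "finite V1" "finite V2" using sub pair_finite_verts finite_subset by blast+
  define N where "N x = {y. (x, y) \<in> parcs G}" for x
  have deg: "out_degree (with_proj G) x = card (N x)" for x
  proof -
    have "out_arcs (with_proj G) x = Pair x ` N x" by (auto simp: out_arcs_def N_def)
    then show ?thesis by (simp add: out_degree_def card_image inj_on_def)
  qed
  have N1: "N x \<subseteq> V2" if "x \<in> V1" for x using that arcs disj by (auto simp: N_def)
  have N2: "N x \<subseteq> V1" if "x \<in> V2" for x using that arcs disj by (auto simp: N_def)
  have full1: "N x = V2" if "x \<in> V1" "card (N x) = m" for x
    using card_subset_eq[OF fin(2) N1] that assms(4) by simp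
  have full2: "N y = V1" if "y \<in> V2" "card (N y) = n" for y
    using card_subset_eq[OF fin(1) N2] that assms(3) by simp
  have sym: "y \<in> N x \<longleftrightarrow> x \<in> N y" for x y
    using arcs_symmetric by (auto simp: N_def)
  have two: "N v = {w \<in> V2. card (N w) = n}" if "card (N v) \<noteq> m"
  proof (rule card_subset_eq[symmetric])
    show "finite (N v)" using N1[OF assms(5)] fin(2) finite_subset by blast
    show "{w \<in> V2. card (N w) = n} \<subseteq> N v" using full2 sym assms(5) by blast
    show "card {w \<in> V2. card (N w) = n} = card (N v)"
      using assms(5,7,8) that by (simp add: deg)
  qed
  have "w \<in> N v \<longleftrightarrow> card (N v) = m \<or> card (N w) = n"
    using two full1[OF assms(5)] assms(6) full2[OF assms(6)] sym assms(5) by blast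
  then show ?thesis by (simp add: deg N_def)
qed

lemma ex_numbering:
  assumes "finite V" "card V = n" "A \<subseteq> V" "card A = 2"
  shows "\<exists>f. bij_betw f V {..<n} \<and> (\<forall>x \<in> V. x \<in> A \<longleftrightarrow> f x < (2::nat))"
proof -
  have n: "2 \<le> n" using assms card_mono by metis
  have finA: "finite A" using assms finite_subset by blast
  obtain g where g: "bij_betw g A {..<2::nat}"
    using finA assms(4) finite_same_card_bij[of A "{..<2::nat}"] by auto
  have "card (V - A) = card {2..<n}" using assms finA by (simp add: card_Diff_subset)
  then obtain h where h: "bij_betw h (V - A) {2..<n}"
    using assms(1) finite_same_card_bij[of "V - A" "{2..<n}"] by auto
  let ?f = "\<lambda>x. if x \<in> A then g x else h x"
  have "bij_betw ?f A {..<2}" using g by (simp cong: bij_betw_cong)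
  moreover have "bij_betw ?f (V - A) {2..<n}"
    by (subst bij_betw_cong[of _ _ h]) (auto simp: h)
  ultimately have "bij_betw ?f (A \<union> (V - A)) ({..<2} \<union> {2..<n})"
    by (rule bij_betw_combine) auto
  moreover have "A \<union> (V - A) = V" "{..<2} \<union> {2..<n} = {..<n}" using assms(3) n by auto
  ultimately have "bij_betw ?f V {..<n}" by simp
  moreover have "x \<in> A \<longleftrightarrow> ?f x < 2" if "x \<in> V" for x
    using that bij_betwE[OF g] bij_betwE[OF h] by (auto simp: Ball_def)
  ultimately show ?thesis by blast
qed

lemma is_B_imp_isomorphic:
  assumes "is_B n m G"
  shows "isomorphic G (B_graph n m)"
proof -
  from assms have "pair_graph G" by (simp add: is_B_def)
  then interpret pair_graph G .
  let ?d = "out_degree (with_proj G)"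
  from assms obtain V1 V2 where bip: "bipartition G V1 V2" and c: "card V1 = n" "card V2 = m"
    and c1: "card {v \<in> V1. ?d v = m} = 2" and c2: "card {v \<in> V2. ?d v = n} = 2"
    and d1: "\<forall>v \<in> V1. ?d v \<noteq> m \<longrightarrow> ?d v = 2"
    unfolding is_B_def by blast
  have V: "V1 \<union> V2 = pverts G" and disj: "V1 \<inter> V2 = {}"
    and arcs: "parcs G \<subseteq> V1 \<times> V2 \<union> V2 \<times> V1"
    using bip by (auto simp: bipartition_def)
  have fin: "finite V1" "finite V2" using V pair_finite_verts by (metis finite_Un)+
  have adj: "(v, w) \<in> parcs G \<longleftrightarrow> ?d v = m \<or> ?d w = n" if "v \<in> V1" "w \<in> V2" for v w
    using full_or_two_adjacent[OF \<open>pair_graph G\<close> bip c that c2 d1] .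
  have adj': "(w, v) \<in> parcs G \<longleftrightarrow> ?d v = m \<or> ?d w = n" if "v \<in> V1" "w \<in> V2" for v w
    using adj[OF that] arcs_symmetric by blast
  obtain f where f: "bij_betw f V1 {..<n}" "\<forall>x \<in> V1. x \<in> {v \<in> V1. ?d v = m} \<longleftrightarrow> f x < 2"
    using ex_numbering[OF fin(1) c(1) _ c1] by blast
  obtain g where g: "bij_betw g V2 {..<m}" "\<forall>x \<in> V2. x \<in> {v \<in> V2. ?d v = n} \<longleftrightarrow> g x < 2"
    using ex_numbering[OF fin(2) c(2) _ c2] by blast
  define h where "h x = (if x \<in> V1 then Inl (f x) else Inr (g x))" for x
  have h1: "h x = Inl (f x)" if "x \<in> V1" for x using that by (simp add: h_def)
  have h2: "h x = Inr (g x)" if "x \<in> V2" for x using that disj by (auto simp: h_def)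
  have f': "f x < n" "?d x = m \<longleftrightarrow> f x < 2" if "x \<in> V1" for x
    using that f bij_betwE by fastforce+
  have g': "g x < m" "?d x = n \<longleftrightarrow> g x < 2" if "x \<in> V2" for x
    using that g bij_betwE by fastforce+
  have "bij_betw (Inl \<circ> f) V1 (Inl ` {..<n})"
    using f(1) by (rule bij_betw_trans) (simp add: bij_betw_def)
  then have b1: "bij_betw h V1 (Inl ` {..<n})"
    by (subst bij_betw_cong[of _ _ "Inl \<circ> f"]) (simp_all add: h1)
  have "bij_betw (Inr \<circ> g) V2 (Inr ` {..<m})"
    using g(1) by (rule bij_betw_trans) (simp add: bij_betw_def)
  then have b2: "bij_betw h V2 (Inr ` {..<m})"
    by (subst bij_betw_cong[of _ _ "Inr \<circ> g"]) (simp_all add: h2)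
  have "bij_betw h (V1 \<union> V2) (Inl ` {..<n} \<union> Inr ` {..<m})"
    using b1 b2 by (rule bij_betw_combine) auto
  then have bij: "bij_betw h (pverts G) (pverts (B_graph n m))"
    by (simp add: V B_graph_def Plus_def)
  have "(u, v) \<in> parcs G \<longleftrightarrow> (h u, h v) \<in> parcs (B_graph n m)"
    if uv: "u \<in> pverts G" "v \<in> pverts G" for u v
  proof -
    consider "u \<in> V1" "v \<in> V1" | "u \<in> V2" "v \<in> V2" | "u \<in> V1" "v \<in> V2" | "u \<in> V2" "v \<in> V1"
      using uv V by blast
    then show ?thesis
    proof cases
      case 1
      then have "(u, v) \<notin> parcs G" using arcs disj by blast
      with 1 show ?thesis by (simp add: h1 B_graph_def)
    next
      case 2
      then have "(u, v) \<notin> parcs G" using arcs disj by blast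
      with 2 show ?thesis by (simp add: h2 B_graph_def)
    next
      case 3
      then show ?thesis using adj[OF 3] f' g' by (simp add: h1 h2 B_graph_def)
    next
      case 4
      then show ?thesis using adj'[OF 4(2,1)] f' g' by (simp add: h1 h2 B_graph_def)
    qed
  qed
  then show ?thesis
    using bij isomorphic_iff[OF pair_wf_digraph pair_digraph.pair_wf_digraph]
      pair_graph_B_graph[of n m] unfolding pair_graph_def by blast
qed

end

theory Submission
  imports Defs
begin

text \<open>
  Two moves suffice for Dominator iff every first move \<open>s\<close> of Staller has an answer \<open>d \<noteq> s\<close> that
  lies in more dominating pairs \<open>{d, d'}\<close> with \<open>d' \<noteq> s\<close> than Staller can spoil with a single
  further move. If the sides \<open>V1\<close>, \<open>V2\<close> of \<open>G\<close> have at least 2 and 3 vertices, this happens iff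
  each side contains two vertices adjacent to the whole opposite side. Hence \<open>G\<close> is critical iff
  such vertices \<open>A \<subseteq> V1\<close>, \<open>B \<subseteq> V2\<close> exist and every edge meets \<open>A \<union> B\<close>, which describes
  \<open>B\<^bsub>n,m\<^esub>\<close> for \<open>n, m \<ge> 3\<close> and degenerates to \<open>K\<^bsub>2,m\<^esub>\<close> for \<open>n = 2\<close>.
\<close>

section \<open>The S-game as a recursion on positions\<close>

lemma staller_moves_simps [simp]:
  "staller_moves [] = []" "staller_moves [a] = [a]" "staller_moves (a # b # p) = a # staller_moves p"
  by (simp_all add: staller_moves_def nths_Cons)

lemma dominator_moves_simps [simp]:
  "dominator_moves [] = []" "dominator_moves [a] = []"
  "dominator_moves (a # b # p) = b # dominator_moves p"
  by (simp_all add: dominator_moves_def nths_Cons)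

lemma length_dominator_moves: "length (dominator_moves p) = length p div 2"
  by (induction p rule: induct_list012) simp_all

lemma dominator_won_staller_move:
  assumes "even (length p)"
  shows "dominator_won G (p @ [v]) \<longleftrightarrow> dominator_won G p"
  using assms by (simp add: dominator_won_def dominator_moves_def nths_append)

lemma dominating_pairD:
  assumes "dominating_set G {x, y}" "v \<in> pverts G" "v \<noteq> x" "v \<noteq> y"
  shows "(x, v) \<in> parcs G \<or> (y, v) \<in> parcs G"
  using assms by (auto simp: dominating_set_def)

lemma not_staller_wonI:
  assumes "dominating_set G D" "D \<inter> set (staller_moves p) = {}"
  shows "\<not> staller_won G p"
  using assms by (auto simp: staller_won_def)

text \<open>Evaluated at positions of even length, where Staller is to move; the number is what
  Dominator has left to spend. A Staller win is excluded both before and after her move because the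
  game stops at the first win.\<close>

primrec dominator_wins_from :: "'a pair_pre_digraph \<Rightarrow> nat \<Rightarrow> 'a list \<Rightarrow> bool" where
  "dominator_wins_from G 0 p \<longleftrightarrow> dominator_won G p"
| "dominator_wins_from G (Suc k) p \<longleftrightarrow> dominator_won G p \<or>
     (\<not> staller_won G p \<and> (\<forall>v \<in> pverts G - set p. \<not> staller_won G (p @ [v]) \<and>
        (\<exists>d \<in> pverts G - set (p @ [v]). dominator_wins_from G k (p @ [v, d]))))"

section \<open>From strategies to the recursion and back\<close>

lemma s_game_position_distinct:
  assumes "legal_strategy G \<sigma>" "s_game_position G \<sigma> p"
  shows "distinct p \<and> set p \<subseteq> pverts G"
  using assms(2)
proof induction
  case (dominator p)
  then show ?case using assms(1) by (auto simp: legal_strategy_def)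
qed auto

text \<open>No vertex is selected twice and a legal move exists until the game is over. Since
  \<open>wins_within\<close> constrains finished positions only, unfinished ones are handled through
  such an extension.\<close>

lemma s_game_position_extends:
  assumes "finite (pverts G)" "legal_strategy G \<sigma>" "s_game_position G \<sigma> p"
  shows "\<exists>q. s_game_position G \<sigma> q \<and> game_over G q \<and> length p \<le> length q"
  using assms(3)
proof (induction "card (pverts G) - length p" arbitrary: p rule: less_induct)
  case less
  have p: "distinct p" "set p \<subseteq> pverts G"
    using s_game_position_distinct[OF assms(2) less.prems] by auto
  show ?case
  proof (cases "game_over G p")
    case True
    with less.prems show ?thesis by blast
  next
    case False
    then have "set p \<subset> pverts G" using p(2) all_selected_game_over by blast
    then have len: "length p < card (pverts G)"
      using psubset_card_mono[OF assms(1)] distinct_card[OF p(1)] by metis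
    obtain v where "v \<in> pverts G - set p" using \<open>set p \<subset> pverts G\<close> by blast
    then obtain x where "s_game_position G \<sigma> (p @ [x])"
      using s_game_position.staller s_game_position.dominator less.prems False by metis
    from less.hyps[OF _ this] len show ?thesis by fastforce
  qed
qed

lemma wins_within_imp_dominator_wins_from:
  assumes "finite (pverts G)" "wins_within G k \<sigma>" "s_game_position G \<sigma> p"
    and "length p + 2 * j = 2 * k"
  shows "dominator_wins_from G j p"
  using assms(3,4)
proof (induction j arbitrary: p)
  case 0
  have legal: "legal_strategy G \<sigma>" using assms(2) by (simp add: wins_within_def)
  have fin: "dominator_won G q" "length q div 2 \<le> k"
    if "s_game_position G \<sigma> q" "game_over G q" for q
    using assms(2) that by (auto simp: wins_within_def length_dominator_moves)
  show ?case
  proof (cases "game_over G p")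
    case True
    then show ?thesis using fin 0 by simp
  next
    case False
    \<comment> \<open>Dominator has spent all \<open>k\<close> moves. If the game could go on for
      one more round, every finished extension would contain more than \<open>k\<close> of his
      moves.\<close>
    have "set p \<subseteq> pverts G" using s_game_position_distinct[OF legal 0(1)] by simp
    moreover have "set p \<noteq> pverts G" using False all_selected_game_over by metis
    ultimately obtain v where v: "v \<in> pverts G - set p" by blast
    have ev: "even (length p)" using 0(2) by presburger
    have q: "s_game_position G \<sigma> (p @ [v])"
      using s_game_position.staller[OF 0(1) ev False v] .
    have nq: "\<not> game_over G (p @ [v])"
      using fin(1)[OF q] dominator_won_staller_move[OF ev] False by (auto simp: game_over_def)
    have "s_game_position G \<sigma> ((p @ [v]) @ [\<sigma> (p @ [v])])"
      using s_game_position.dominator[OF q _ nq] ev by simp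
    from s_game_position_extends[OF assms(1) legal this]
    obtain q where "s_game_position G \<sigma> q" "game_over G q" "length p + 2 \<le> length q" by auto
    with fin(2)[of q] 0(2) show ?thesis by linarith
  qed
next
  case (Suc j)
  have legal: "legal_strategy G \<sigma>" using assms(2) by (simp add: wins_within_def)
  have fin: "dominator_won G q" if "s_game_position G \<sigma> q" "game_over G q" for q
    using assms(2) that by (auto simp: wins_within_def)
  have ev: "even (length p)" using Suc.prems(2) by presburger
  show ?case
  proof (cases "dominator_won G p")
    case False
    then have np: "\<not> game_over G p" using fin Suc.prems(1) by blast
    have "\<not> staller_won G (p @ [v]) \<and>
        (\<exists>d \<in> pverts G - set (p @ [v]). dominator_wins_from G j (p @ [v, d]))"
      if v: "v \<in> pverts G - set p" for v
    proof -
      have q: "s_game_position G \<sigma> (p @ [v])"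
        using s_game_position.staller[OF Suc.prems(1) ev np v] .
      have nq: "\<not> game_over G (p @ [v])"
        using fin[OF q] dominator_won_staller_move[OF ev] False by blast
      have r: "s_game_position G \<sigma> (p @ [v, \<sigma> (p @ [v])])"
        using s_game_position.dominator[OF q _ nq] ev by simp
      have "\<sigma> (p @ [v]) \<in> pverts G - set (p @ [v])"
        using legal q nq ev unfolding legal_strategy_def by (metis even_Suc length_append_singleton)
      moreover have "dominator_wins_from G j (p @ [v, \<sigma> (p @ [v])])"
        using Suc.IH[OF r] Suc.prems(2) by simp
      ultimately show ?thesis using nq by (auto simp: game_over_def)
    qed
    then show ?thesis using np by (simp add: game_over_def)
  qed simp
qed

text \<open>The strategy selects any vertex that keeps the recursion true.\<close>

lemma dominator_wins_from_imp_wins_within: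
  assumes "dominator_wins_from G k []"
  shows "\<exists>\<sigma>. wins_within G k \<sigma>"
proof -
  \<comment> \<open>At odd length, \<open>(length p + 1) div 2\<close> counts Dominator's moves
    including the one about to be made.\<close>
  define good where "good p d \<longleftrightarrow> d \<in> pverts G - set p \<and>
    dominator_wins_from G (k - (length p + 1) div 2) (p @ [d])" for p d
  define \<sigma> where "\<sigma> p = (SOME d. good p d)" for p
  have \<sigma>: "good p (\<sigma> p)" if "\<exists>d. good p d" for p
    unfolding \<sigma>_def using that by (rule someI_ex)
  \<comment> \<open>The length bound in this invariant later gives the bound on the number of
    Dominator's moves.\<close>
  have inv: "(even (length p) \<longrightarrow> dominator_wins_from G (k - length p div 2) p) \<and>
      (odd (length p) \<longrightarrow> \<not> game_over G p \<and> (\<exists>d. good p d)) \<and> length p \<le> 2 * k"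
    if "s_game_position G \<sigma> p" for p
    using that
  proof induction
    case start
    then show ?case using assms by simp
  next
    case (staller p v)
    then have W: "dominator_wins_from G (k - length p div 2) p" and le: "length p \<le> 2 * k"
      and nd: "\<not> dominator_won G p" by (auto simp: game_over_def)
    then obtain j where j: "k - length p div 2 = Suc j" by (cases "k - length p div 2") auto
    with W nd staller have "\<not> staller_won G (p @ [v])"
      and ex: "\<exists>d \<in> pverts G - set (p @ [v]). dominator_wins_from G j (p @ [v, d])" by auto
    then have "\<not> game_over G (p @ [v])"
      using nd dominator_won_staller_move[OF staller.hyps(2)] by (auto simp: game_over_def)
    moreover have "k - (length (p @ [v]) + 1) div 2 = j" using j by simp
    then have "\<exists>d. good (p @ [v]) d" using ex by (auto simp: good_def)
    moreover have "length (p @ [v]) \<le> 2 * k" using j staller.hyps(2) by auto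
    ultimately show ?case using staller.hyps(2) by simp
  next
    case (dominator p)
    then have "good p (\<sigma> p)" using \<sigma> by blast
    moreover have "length p + 1 \<le> 2 * k"
      using dominator.IH dominator.hyps(2) by (metis Suc_eq_plus1 Suc_leI dvd_triv_left le_neq_implies_less)
    ultimately show ?case using dominator.hyps(2) by (auto simp: good_def)
  qed
  have "legal_strategy G \<sigma>"
    using inv \<sigma> unfolding legal_strategy_def good_def by blast
  moreover have "dominator_won G p \<and> length (dominator_moves p) \<le> k"
    if p: "s_game_position G \<sigma> p" "game_over G p" for p
  proof -
    have W: "dominator_wins_from G (k - length p div 2) p" "length p \<le> 2 * k"
      using inv[OF p(1)] p(2) by auto
    have "dominator_won G p"
    proof (rule ccontr)
      assume nd: "\<not> dominator_won G p"
      then have "staller_won G p" using p(2) by (simp add: game_over_def)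
      with nd W(1) show False by (cases "k - length p div 2") auto
    qed
    then show ?thesis using W(2) by (simp add: length_dominator_moves)
  qed
  ultimately show ?thesis by (auto simp: wins_within_def)
qed

lemma wins_within_mono:
  assumes "wins_within G j \<sigma>" "j \<le> k"
  shows "wins_within G k \<sigma>"
  using assms unfolding wins_within_def by fastforce

lemma gamma_MB'_le_iff:
  assumes "finite (pverts G)"
  shows "gamma_MB' G \<le> enat k \<longleftrightarrow> dominator_wins_from G k []"
proof
  let ?K = "{enat k | k. \<exists>\<sigma>. wins_within G k \<sigma>}"
  assume le: "gamma_MB' G \<le> enat k"
  \<comment> \<open>A finite bound rules out the infimum of the empty set, and a nonempty set in
    \<open>enat\<close> attains its infimum.\<close>
  then have "?K \<noteq> {}" unfolding gamma_MB'_def by (metis Inf_empty enat_ord_code(5) leD top_enat_def enat_ord_simps(4))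
  then have "Inf ?K \<in> ?K" unfolding Inf_enat_def using LeastI_ex[of "\<lambda>x. x \<in> ?K"] by auto
  then obtain j \<sigma> where "gamma_MB' G = enat j" "wins_within G j \<sigma>"
    unfolding gamma_MB'_def by blast
  with le have "wins_within G k \<sigma>" using wins_within_mono by fastforce
  then show "dominator_wins_from G k []"
    using wins_within_imp_dominator_wins_from[OF assms _ s_game_position.start] by simp
next
  assume "dominator_wins_from G k []"
  then show "gamma_MB' G \<le> enat k"
    unfolding gamma_MB'_def by (intro Inf_lower) (auto dest: dominator_wins_from_imp_wins_within)
qed

section \<open>Winning in one or two moves as a condition on dominating sets\<close>

lemma dominator_wins_1_iff:
  "dominator_wins_from G 1 [] \<longleftrightarrow> (\<forall>s \<in> pverts G. \<exists>d \<in> pverts G - {s}. dominating_set G {d})"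
proof -
  \<comment> \<open>The \<open>staller_won\<close> clauses disappear: any dominating set that avoids
    Staller's selection refutes her win.\<close>
  have "\<not> staller_won G []" by (auto simp: staller_won_def dominating_set_def)
  moreover have "\<not> staller_won G [s]" if "dominating_set G {d}" "d \<noteq> s" for s d
    using not_staller_wonI[OF that(1)] that(2) by simp
  moreover have "dominating_set G {} \<longleftrightarrow> pverts G = {}" by (auto simp: dominating_set_def)
  ultimately show ?thesis by (simp add: dominator_won_def) blast
qed

text \<open>
  The second moves may coincide with first ones: \<open>s' = s\<close> makes the condition cover the graphs
  in which no vertex is left for Staller's second move, and \<open>d' = d\<close> stands for a win of
  Dominator with his first move.
\<close>

lemma dominator_wins_2_iff:
  "dominator_wins_from G 2 [] \<longleftrightarrow> (\<forall>s \<in> pverts G. \<exists>d \<in> pverts G - {s}. \<forall>s' \<in> pverts G - {d}.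
     \<exists>d' \<in> pverts G - {s, s'}. dominating_set G {d, d'})" (is "?W \<longleftrightarrow> ?C")
proof -
  let ?V = "pverts G"
  have empty: "dominating_set G {} \<longleftrightarrow> ?V = {}" by (auto simp: dominating_set_def)
  have "\<not> staller_won G []" by (auto simp: staller_won_def dominating_set_def)
  then have W: "?W \<longleftrightarrow> ?V = {} \<or> (\<forall>s \<in> ?V. \<not> staller_won G [s] \<and>
      (\<exists>d \<in> ?V - {s}. dominating_set G {d} \<or> \<not> staller_won G [s, d] \<and>
        (\<forall>s' \<in> ?V - {s, d}. \<not> staller_won G [s, d, s'] \<and>
          (\<exists>d' \<in> ?V - {s, d, s'}. dominating_set G {d, d'}))))"
    by (simp add: numeral_2_eq_2 dominator_won_def empty)
  show ?thesis
  proof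
    assume ?W
    show ?C
    proof
      fix s assume s: "s \<in> ?V"
      with \<open>?W\<close> obtain d where ns: "\<not> staller_won G [s]" and d: "d \<in> ?V - {s}"
        and r: "dominating_set G {d} \<or>
          (\<forall>s' \<in> ?V - {s, d}. \<exists>d' \<in> ?V - {s, d, s'}. dominating_set G {d, d'})"
        unfolding W by blast
      have "\<exists>d' \<in> ?V - {s, s'}. dominating_set G {d, d'}" if s': "s' \<in> ?V - {d}" for s'
      proof (cases "dominating_set G {d}")
        case True
        then show ?thesis using s' d by (intro bexI[of _ d]) auto
      next
        case False
        with r have r: "\<exists>d' \<in> ?V - {s, d, t}. dominating_set G {d, d'}" if "t \<in> ?V - {s, d}" for t
          using that by blast
        \<comment> \<open>If \<open>s\<close> and \<open>d\<close> were the only vertices, a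
          dominating set avoiding \<open>s\<close> would lie inside \<open>{d}\<close>, so
          \<open>d\<close> alone would dominate.\<close>
        have "?V \<noteq> {s, d}"
        proof
          assume V: "?V = {s, d}"
          obtain D where "dominating_set G D" "s \<notin> D" using ns by (auto simp: staller_won_def)
          then have "dominating_set G {d}" using V d by (auto simp: dominating_set_def)
          with False show False by simp
        qed
        \<comment> \<open>The answer to an arbitrary second move \<open>t\<close> also serves for
          \<open>s' = s\<close>, as it avoids \<open>s\<close>.\<close>
        then obtain t where "t \<in> ?V - {s, d}" using s d by blast
        with r[OF this] r[of s'] s' show ?thesis by (cases "s' = s") auto
      qed
      with d show "\<exists>d \<in> ?V - {s}. \<forall>s' \<in> ?V - {d}. \<exists>d' \<in> ?V - {s, s'}. dominating_set G {d, d'}"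
        by blast
    qed
  next
    assume ?C
    have "\<not> staller_won G [s] \<and>
      (\<exists>d \<in> ?V - {s}. dominating_set G {d} \<or> \<not> staller_won G [s, d] \<and>
        (\<forall>s' \<in> ?V - {s, d}. \<not> staller_won G [s, d, s'] \<and>
          (\<exists>d' \<in> ?V - {s, d, s'}. dominating_set G {d, d'})))" if s: "s \<in> ?V" for s
    proof -
      from \<open>?C\<close> s obtain d where d: "d \<in> ?V - {s}"
        and r: "\<And>s'. s' \<in> ?V - {d} \<Longrightarrow> \<exists>d' \<in> ?V - {s, s'}. dominating_set G {d, d'}" by blast
      \<comment> \<open>The instance \<open>s' = s\<close> yields a dominating pair avoiding
        \<open>s\<close>, which shows that Staller has not won yet.\<close>
      from r[of s] s d obtain e where "e \<noteq> s" "dominating_set G {d, e}" by blast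
      then have ns: "\<not> staller_won G [s]" "\<not> staller_won G [s, d]"
        using d not_staller_wonI[OF \<open>dominating_set G {d, e}\<close>] by auto
      show ?thesis
      proof (cases "dominating_set G {d}")
        case True
        with d ns show ?thesis by blast
      next
        case False
        have "\<not> staller_won G [s, d, s'] \<and> (\<exists>d' \<in> ?V - {s, d, s'}. dominating_set G {d, d'})"
          if s': "s' \<in> ?V - {s, d}" for s'
        proof -
          obtain d' where d': "d' \<in> ?V - {s, s'}" "dominating_set G {d, d'}"
            using r[of s'] s' by blast
          have "d' \<noteq> d" using d'(2) False by auto
          moreover have "\<not> staller_won G [s, d, s']"
            using d d' s' by (intro not_staller_wonI[OF d'(2)]) auto
          ultimately show ?thesis using d' by blast
        qed
        with d ns show ?thesis by blast
      qed
    qed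
    then show ?W unfolding W by blast
  qed
qed

lemma gamma_MB'_critical_2_iff:
  assumes "finite (pverts G)"
  shows "gamma_MB'_critical 2 G \<longleftrightarrow> dominator_wins_from G 2 [] \<and> \<not> dominator_wins_from G 1 [] \<and>
    (\<forall>(u, v) \<in> parcs G. \<not> dominator_wins_from (del_edge G u v) 2 [])"
proof -
  have "gamma_MB' G = enat 2 \<longleftrightarrow> gamma_MB' G \<le> enat 2 \<and> \<not> gamma_MB' G \<le> enat 1"
    by (cases "gamma_MB' G") auto
  moreover have "finite (pverts (del_edge G u v))" for u v
    using assms by (simp add: del_edge_def)
  ultimately show ?thesis
    unfolding gamma_MB'_critical_def
    by (auto simp: gamma_MB'_le_iff[OF assms] gamma_MB'_le_iff[symmetric] not_le)
qed

section \<open>Bipartite graphs in which two moves of Dominator suffice\<close>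

text \<open>\<open>connected\<close> means reachability in the symmetric closure, and no step of a
  walk there, in either direction, leaves \<open>S\<close>.\<close>

lemma connected_closed_eq:
  assumes "pair_graph G" "connected (with_proj G)" "S \<noteq> {}" "S \<subseteq> pverts G"
    and closed: "\<And>u v. (u, v) \<in> parcs G \<Longrightarrow> u \<in> S \<longleftrightarrow> v \<in> S"
  shows "S = pverts G"
proof -
  interpret pair_graph G by fact
  let ?H = "with_proj (mk_symmetric (with_proj G))"
  interpret H: pair_wf_digraph "mk_symmetric (with_proj G)" by (rule wellformed_mk_symmetric)
  obtain a where a: "a \<in> S" using assms(3) by blast
  have "v \<in> S" if "v \<in> pverts G" for v
  proof -
    have "a \<rightarrow>\<^sup>*\<^bsub>?H\<^esub> v"
      using assms(2,4) a that by (auto simp: connected_def strongly_connected_def)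
    then show ?thesis
    proof (induction rule: H.reachable_induct)
      case base
      show ?case by (fact a)
    next
      case (step x y)
      then have "(x, y) \<in> parcs G \<or> (y, x) \<in> parcs G" by (auto simp: mk_symmetric_def)
      with step show ?case using closed by blast
    qed
  qed
  with assms(4) show ?thesis by blast
qed

lemma pair_graph_del_edge:
  assumes "pair_graph G"
  shows "pair_graph (del_edge G u v)"
proof -
  interpret pair_graph G by fact
  show ?thesis
  proof
    show "symmetric (with_proj (del_edge G u v))"
      using arcs_symmetric by (auto simp: symmetric_def sym_def del_edge_def)
  qed (use in_arcsD1 in_arcsD2 no_loops' in \<open>auto simp: del_edge_def\<close>)
qed

text \<open>Pairing strategy: Dominator replies in the matching edge that Staller has just touched,
  and one vertex from each edge dominates.\<close>

lemma dominator_wins_2_of_perfect_matching: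
  assumes "pair_graph G" "pverts G = {a, b, c, d}" "distinct [a, b, c, d]"
    and "(a, c) \<in> parcs G" "(b, d) \<in> parcs G"
  shows "dominator_wins_from G 2 []"
proof -
  interpret pair_graph G by fact
  have sym: "(c, a) \<in> parcs G" "(d, b) \<in> parcs G" using assms(4,5) arcs_symmetric by blast+
  have dom: "dominating_set G {x, y}" "dominating_set G {y, x}"
    if "x \<in> {a, c}" "y \<in> {b, d}" for x y
    using that sym assms(2,4,5) by (auto simp: dominating_set_def)
  have answer: "\<exists>y' \<in> pverts G - {s, s'}. dominating_set G {x, y'}"
    if "s \<in> {a, c} \<and> x \<in> {a, c} \<or> s \<in> {b, d} \<and> x \<in> {b, d}" for s s' x
    using that
  proof
    assume "s \<in> {a, c} \<and> x \<in> {a, c}"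
    then show ?thesis using assms(2,3) dom(1)
      by (intro bexI[of _ "if s' = b then d else b"]) auto
  next
    assume "s \<in> {b, d} \<and> x \<in> {b, d}"
    then show ?thesis using assms(2,3) dom(2)
      by (intro bexI[of _ "if s' = a then c else a"]) auto
  qed
  show ?thesis
    unfolding dominator_wins_2_iff
  proof
    fix s assume "s \<in> pverts G"
    then obtain x where "x \<in> pverts G - {s}"
      "s \<in> {a, c} \<and> x \<in> {a, c} \<or> s \<in> {b, d} \<and> x \<in> {b, d}"
      using assms(2,3) by auto
    then show "\<exists>x \<in> pverts G - {s}. \<forall>s' \<in> pverts G - {x}.
        \<exists>y' \<in> pverts G - {s, s'}. dominating_set G {x, y'}"
      using answer by blast
  qed
qed

text \<open>Adjacency replaces the degree conditions of \<open>is_B\<close> so that sides of size 2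
  are covered too: if \<open>card V1 = 2\<close>, then \<open>A = V1\<close> and the graph is
  complete bipartite, whatever \<open>B\<close> is.\<close>

definition B_shape :: "'a pair_pre_digraph \<Rightarrow> 'a set \<Rightarrow> 'a set \<Rightarrow> 'a set \<Rightarrow> 'a set \<Rightarrow> bool" where
  "B_shape G V1 V2 A B \<longleftrightarrow> bipartition G V1 V2 \<and> A \<subseteq> V1 \<and> card A = 2 \<and> B \<subseteq> V2 \<and> card B = 2 \<and>
     (\<forall>u \<in> V1. \<forall>v \<in> V2. (u, v) \<in> parcs G \<longleftrightarrow> u \<in> A \<or> v \<in> B)"

locale bipartitioned_graph = pair_graph G for G :: "'a pair_pre_digraph" +
  fixes V1 V2 :: "'a set"
  assumes bipartition: "bipartition G V1 V2"
begin

lemma verts: "pverts G = V1 \<union> V2" and disjoint: "V1 \<inter> V2 = {}"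
  and arcs_cross: "(u, v) \<in> parcs G \<Longrightarrow> u \<in> V1 \<and> v \<in> V2 \<or> u \<in> V2 \<and> v \<in> V1"
  using bipartition by (auto simp: bipartition_def)

lemma in_verts: "v \<in> V1 \<Longrightarrow> v \<in> pverts G" "v \<in> V2 \<Longrightarrow> v \<in> pverts G"
  and in_parts: "v \<in> pverts G \<Longrightarrow> v \<in> V1 \<or> v \<in> V2"
  and not_both: "v \<in> V1 \<Longrightarrow> v \<notin> V2"
  using verts disjoint by auto

lemma no_arc: "u \<in> V1 \<Longrightarrow> v \<in> V1 \<Longrightarrow> (u, v) \<notin> parcs G" "u \<in> V2 \<Longrightarrow> v \<in> V2 \<Longrightarrow> (u, v) \<notin> parcs G"
  using arcs_cross not_both by blast+

lemma finite_parts: "finite V1" "finite V2"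
  using pair_finite_verts by (simp_all add: verts)

lemma swap: "bipartitioned_graph G V2 V1"
  by unfold_locales (use bipartition in \<open>auto simp: bipartition_def\<close>)

lemma del_edge: "bipartitioned_graph (del_edge G u v) V1 V2"
  using pair_graph_del_edge[OF pair_graph_axioms] bipartition
  by (auto simp: bipartitioned_graph_def bipartitioned_graph_axioms_def bipartition_def del_edge_def)

text \<open>An isolated vertex lies in every dominating set, so Staller would win by selecting it
  first.\<close>

lemma neighbour_if_dominator_wins_2:
  assumes "dominator_wins_from G 2 []" "s \<in> pverts G"
  obtains x where "(x, s) \<in> parcs G"
proof -
  from assms obtain d where d: "d \<in> pverts G - {s}"
    "\<forall>s' \<in> pverts G - {d}. \<exists>d' \<in> pverts G - {s, s'}. dominating_set G {d, d'}"
    unfolding dominator_wins_2_iff by blast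
  then obtain d' where "d' \<noteq> s" "dominating_set G {d, d'}" using assms(2) by blast
  with d(1) assms(2) that show ?thesis by (auto simp: dominating_set_def)
qed

text \<open>Otherwise the graph is a star. Its centre dominates, so Staller must start there to
  prevent a win in one move; afterwards she takes a leaf, which no other leaf dominates.\<close>

lemma two_le_card_part:
  assumes C2: "dominator_wins_from G 2 []" and C1: "\<not> dominator_wins_from G 1 []"
  shows "2 \<le> card V1"
proof (rule ccontr)
  assume "\<not> 2 \<le> card V1"
  then have le: "card V1 \<le> 1" by simp
  obtain s where s: "s \<in> pverts G" "\<And>x. x \<in> pverts G - {s} \<Longrightarrow> \<not> dominating_set G {x}"
    using C1 unfolding dominator_wins_1_iff by blast
  obtain x where x: "(x, s) \<in> parcs G" using neighbour_if_dominator_wins_2[OF C2 s(1)] .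
  obtain c where c: "V1 = {c}"
    using arcs_cross[OF x] le card_le_Suc0_iff_eq[OF finite_parts(1)] by auto
  have star: "(c, y) \<in> parcs G \<and> (y, c) \<in> parcs G" if y: "y \<in> V2" for y
  proof -
    obtain x where x: "(x, y) \<in> parcs G"
      using neighbour_if_dominator_wins_2[OF C2 in_verts(2)[OF y]] .
    then have "x = c" using arcs_cross[OF x] not_both[of y] y c by auto
    with x arcs_symmetric show ?thesis by blast
  qed
  have "dominating_set G {c}" using star c verts by (auto simp: dominating_set_def)
  then have "s = c" using s(2)[of c] c verts by auto
  from C2 obtain d where d: "d \<in> pverts G - {c}"
    "\<forall>s' \<in> pverts G - {d}. \<exists>d' \<in> pverts G - {c, s'}. dominating_set G {d, d'}"
    unfolding dominator_wins_2_iff using s(1) \<open>s = c\<close> by blast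
  \<comment> \<open>With \<open>d\<close> as the only leaf, \<open>{d}\<close> would dominate; hence
    a second leaf \<open>y\<close> is available to Staller.\<close>
  have "\<not> dominating_set G {d}" using s(2) d(1) \<open>s = c\<close> by blast
  then obtain y where y: "y \<in> V2" "y \<noteq> d"
    using star[of d] d(1) c verts by (auto simp: dominating_set_def)
  then obtain d' where d': "d' \<in> pverts G - {c, y}" "dominating_set G {d, d'}"
    using d(2) in_verts(2) by blast
  have "(d, y) \<in> parcs G \<or> (d', y) \<in> parcs G"
    using dominating_pairD[OF d'(2) in_verts(2)[OF y(1)]] y(2) d'(1) by blast
  moreover have "d \<in> V2" "d' \<in> V2" using d(1) d'(1) c verts by auto
  ultimately show False using no_arc(2) y(1) by blast
qed

text \<open>
  If Staller starts at \<open>s \<in> V1\<close>, then a pair dominating \<open>G\<close> and avoiding \<open>s\<close> meets both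
  sides. Two such pairs \<open>{d, d1}\<close>, \<open>{d, d2}\<close> force a vertex of \<open>V1\<close> among them that is adjacent
  to all of \<open>V2\<close>.
\<close>

lemma full_vertex_avoiding:
  assumes C2: "dominator_wins_from G 2 []" and m: "3 \<le> card V2" and s: "s \<in> V1"
  obtains x where "x \<in> V1" "x \<noteq> s" "\<forall>y \<in> V2. (x, y) \<in> parcs G"
proof -
  have s': "s \<in> pverts G" "s \<notin> V2" using s in_verts not_both by auto
  from C2 s'(1) obtain d where d: "d \<in> pverts G - {s}"
    "\<And>s'. s' \<in> pverts G - {d} \<Longrightarrow> \<exists>d' \<in> pverts G - {s, s'}. dominating_set G {d, d'}"
    unfolding dominator_wins_2_iff by blast
  \<comment> \<open>The neighbour of \<open>s\<close> in the pair lies in \<open>V2\<close>. A third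
    vertex of \<open>V2\<close>, outside the pair, needs a neighbour in \<open>V1\<close>.\<close>
  have cross: "x \<in> V1 \<and> y \<in> V2 \<or> x \<in> V2 \<and> y \<in> V1"
    if xy: "dominating_set G {x, y}" "x \<noteq> s" "y \<noteq> s" for x y
  proof -
    have "(x, s) \<in> parcs G \<or> (y, s) \<in> parcs G"
      using dominating_pairD[OF xy(1) s'(1)] xy(2,3) by blast
    then have or: "x \<in> V2 \<or> y \<in> V2" using arcs_cross s'(2) by blast
    have "card {x, y} < card V2" using m by (simp add: card_insert_if)
    then have "\<not> V2 \<subseteq> {x, y}" using card_mono[of "{x, y}" V2] by auto
    then obtain z where z: "z \<in> V2" "z \<noteq> x" "z \<noteq> y" by blast
    then have "(x, z) \<in> parcs G \<or> (y, z) \<in> parcs G"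
      using dominating_pairD[OF xy(1) in_verts(2)] by blast
    then have "x \<in> V1 \<or> y \<in> V1" using arcs_cross not_both z(1) by blast
    with or show ?thesis using not_both by blast
  qed
  have adj: "(x, z) \<in> parcs G"
    if "dominating_set G {x, y}" "x \<in> V1" "y \<in> V2" "z \<in> V2 - {y}" for x y z
    using dominating_pairD[OF that(1) in_verts(2)[of z]] that(2-4) no_arc(2) not_both by blast
  have adj': "(z, y) \<in> parcs G"
    if "dominating_set G {x, y}" "x \<in> V1" "y \<in> V2" "z \<in> V1 - {x}" for x y z
    using dominating_pairD[OF that(1) in_verts(1)[of z]] that(2-4) no_arc(1) not_both
      arcs_symmetric by blast
  obtain d1 where d1: "d1 \<noteq> s" "dominating_set G {d, d1}" using d(2)[of s] d(1) s'(1) by blast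
  have c1: "d \<in> V1 \<and> d1 \<in> V2 \<or> d \<in> V2 \<and> d1 \<in> V1" using cross[OF d1(2)] d(1) d1(1) by blast
  then have "d1 \<in> pverts G - {d}" using in_verts not_both by blast
  \<comment> \<open>Staller's second move is now \<open>d1\<close>, which forces another partner for
    \<open>d\<close>.\<close>
  then obtain d2 where d2: "d2 \<noteq> s" "d2 \<noteq> d1" "dominating_set G {d, d2}" using d(2) by blast
  have c2: "d \<in> V1 \<and> d2 \<in> V2 \<or> d \<in> V2 \<and> d2 \<in> V1" using cross[OF d2(3)] d(1) d2(1) by blast
  show thesis
  proof (cases "d \<in> V1")
    case True
    then have "d1 \<in> V2" "d2 \<in> V2" using c1 c2 not_both by auto
    \<comment> \<open>The pair with \<open>d1\<close> leaves only the arc from \<open>d\<close> to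
      \<open>d1\<close> open, and the pair with \<open>d2\<close> supplies it.\<close>
    then have "\<forall>y \<in> V2. (d, y) \<in> parcs G"
      using adj[OF d1(2) True] adj[OF d2(3) True] d2(2) by blast
    with that True d(1) show thesis by blast
  next
    case False
    then have V: "d \<in> V2" "d1 \<in> V1" "d2 \<in> V1" using c1 c2 by auto
    have "dominating_set G {d1, d}" "dominating_set G {d2, d}"
      using d1(2) d2(3) by (simp_all add: insert_commute)
    \<comment> \<open>The first pair joins \<open>d1\<close> to all of \<open>V2\<close> except
      \<open>d\<close>; in the second pair only \<open>d\<close> can dominate
      \<open>d1\<close>.\<close>
    then have "\<forall>y \<in> V2. (d1, y) \<in> parcs G"
      using adj[of d1 d] adj'[of d2 d d1] V d2(2) by blast
    with that V d1(1) show thesis by blast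
  qed
qed

text \<open>The second full vertex appears when Staller starts at the first one.\<close>

lemma two_full_vertices:
  assumes "dominator_wins_from G 2 []" "3 \<le> card V2" "V1 \<noteq> {}"
  obtains A where "A \<subseteq> V1" "card A = 2" "A \<times> V2 \<subseteq> parcs G"
proof -
  obtain s where "s \<in> V1" using assms(3) by blast
  from full_vertex_avoiding[OF assms(1,2) this]
  obtain x where x: "x \<in> V1" "\<forall>z \<in> V2. (x, z) \<in> parcs G" by blast
  from full_vertex_avoiding[OF assms(1,2) x(1)]
  obtain y where "y \<in> V1" "y \<noteq> x" "\<forall>z \<in> V2. (y, z) \<in> parcs G" by blast
  with x that[of "{x, y}"] show thesis by auto
qed

lemma dominator_wins_2_iff_full:
  assumes n: "2 \<le> card V1" and m: "3 \<le> card V2"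
  shows "dominator_wins_from G 2 [] \<longleftrightarrow>
    (\<exists>A B. A \<subseteq> V1 \<and> card A = 2 \<and> B \<subseteq> V2 \<and> card B = 2 \<and> A \<times> V2 \<union> V1 \<times> B \<subseteq> parcs G)"
proof
  assume C2: "dominator_wins_from G 2 []"
  obtain A where A: "A \<subseteq> V1" "card A = 2" "A \<times> V2 \<subseteq> parcs G"
  proof (rule two_full_vertices[OF C2 m])
    show "V1 \<noteq> {}" using n by auto
  qed
  obtain B where B: "B \<subseteq> V2" "card B = 2" "V1 \<times> B \<subseteq> parcs G"
  proof (cases "card V1 = 2")
    \<comment> \<open>The swapped lemma needs three vertices in \<open>V1\<close>. Here
      \<open>A\<close> is all of \<open>V1\<close>, so every vertex of \<open>V2\<close> is full and
      any two of them serve as \<open>B\<close>.\<close>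
    case True
    then have "A = V1" using A card_subset_eq finite_parts(1) by metis
    moreover obtain B where "B \<subseteq> V2" "card B = 2"
      using obtain_subset_with_card_n[of 2 V2] m by auto
    ultimately show ?thesis using that A(3) by blast
  next
    case False
    interpret swap: bipartitioned_graph G V2 V1 by (fact swap)
    obtain B where "B \<subseteq> V2" "card B = 2" "B \<times> V1 \<subseteq> parcs G"
    proof (rule swap.two_full_vertices[OF C2])
      show "3 \<le> card V1" "V2 \<noteq> {}" using False n m by auto
    qed
    then show ?thesis using that arcs_symmetric by blast
  qed
  with A show "\<exists>A B. A \<subseteq> V1 \<and> card A = 2 \<and> B \<subseteq> V2 \<and> card B = 2 \<and> A \<times> V2 \<union> V1 \<times> B \<subseteq> parcs G"
    by blast
next
  assume "\<exists>A B. A \<subseteq> V1 \<and> card A = 2 \<and> B \<subseteq> V2 \<and> card B = 2 \<and> A \<times> V2 \<union> V1 \<times> B \<subseteq> parcs G"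
  then obtain A B where A: "A \<subseteq> V1" "card A = 2" and B: "B \<subseteq> V2" "card B = 2"
    and arcs: "A \<times> V2 \<union> V1 \<times> B \<subseteq> parcs G" by blast
  \<comment> \<open>Dominator first takes a full vertex on the side of \<open>s\<close>. Each of the
    two full vertices opposite completes a dominating pair, and \<open>s'\<close> spoils at most
    one.\<close>
  have dom: "dominating_set G {a, b}" "dominating_set G {b, a}" if "a \<in> A" "b \<in> B" for a b
    using that A(1) B(1) arcs arcs_symmetric verts by (auto simp: dominating_set_def)
  have other: "\<exists>x \<in> X. x \<noteq> t" if "card X = 2" for X :: "'a set" and t
    using that by (auto simp: card_2_iff)
  show "dominator_wins_from G 2 []"
    unfolding dominator_wins_2_iff
  proof
    fix s assume "s \<in> pverts G"
    then consider "s \<in> V1" "s \<notin> V2" | "s \<in> V2" "s \<notin> V1" using in_parts not_both by blast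
    then show "\<exists>d \<in> pverts G - {s}. \<forall>s' \<in> pverts G - {d}.
        \<exists>d' \<in> pverts G - {s, s'}. dominating_set G {d, d'}"
    proof cases
      case 1
      obtain d where d: "d \<in> A" "d \<noteq> s" using other[OF A(2)] by blast
      have "\<exists>d' \<in> pverts G - {s, s'}. dominating_set G {d, d'}" for s'
      proof -
        obtain d' where "d' \<in> B" "d' \<noteq> s'" using other[OF B(2)] by blast
        with d(1) dom(1) B(1) 1(2) in_verts(2) show ?thesis by blast
      qed
      then show ?thesis using d A(1) in_verts(1) by blast
    next
      case 2
      obtain d where d: "d \<in> B" "d \<noteq> s" using other[OF B(2)] by blast
      have "\<exists>d' \<in> pverts G - {s, s'}. dominating_set G {d, d'}" for s'
      proof -
        obtain d' where "d' \<in> A" "d' \<noteq> s'" using other[OF A(2)] by blast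
        with d(1) dom(2) A(1) 2(2) in_verts(1) show ?thesis by blast
      qed
      then show ?thesis using d B(1) in_verts(2) by blast
    qed
  qed
qed

section \<open>Criticality through edge deletion\<close>

lemma not_dominator_wins_1:
  assumes n: "2 \<le> card V1" and m: "2 \<le> card V2"
  shows "\<not> dominator_wins_from G 1 []"
proof -
  have other: "\<exists>y \<in> X. y \<noteq> x" if "2 \<le> card X" for X :: "'a set" and x
    using that card_mono[of "{x}" X] by fastforce
  have "\<not> dominating_set G {x}" for x
  proof
    assume "dominating_set G {x}"
    then have "x \<in> pverts G" "\<And>y. y \<in> pverts G \<Longrightarrow> y \<noteq> x \<Longrightarrow> (x, y) \<in> parcs G"
      by (auto simp: dominating_set_def)
    then show False using other[OF n] other[OF m] in_verts in_parts no_arc by meson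
  qed
  moreover have "pverts G \<noteq> {}" using n verts by auto
  ultimately show ?thesis unfolding dominator_wins_1_iff by blast
qed

lemma critical_iff_B_shape:
  assumes n: "2 \<le> card V1" and m: "3 \<le> card V2"
  shows "gamma_MB'_critical 2 G \<longleftrightarrow> (\<exists>A B. B_shape G V1 V2 A B)"
proof
  assume crit: "gamma_MB'_critical 2 G"
  then have C2: "dominator_wins_from G 2 []"
    and del: "\<And>u v. (u, v) \<in> parcs G \<Longrightarrow> \<not> dominator_wins_from (del_edge G u v) 2 []"
    using gamma_MB'_critical_2_iff[OF pair_finite_verts] by auto
  obtain A B where A: "A \<subseteq> V1" "card A = 2" and B: "B \<subseteq> V2" "card B = 2"
    and arcs: "A \<times> V2 \<union> V1 \<times> B \<subseteq> parcs G"
    using C2 unfolding dominator_wins_2_iff_full[OF n m] by blast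
  have "u \<in> A \<or> v \<in> B" if uv: "(u, v) \<in> parcs G" "u \<in> V1" "v \<in> V2" for u v
  proof (rule ccontr)
    assume "\<not> (u \<in> A \<or> v \<in> B)"
    \<comment> \<open>An edge missing \<open>A\<close> and \<open>B\<close> can be deleted without
      damage to the full vertices.\<close>
    then have "A \<times> V2 \<union> V1 \<times> B \<subseteq> parcs (del_edge G u v)"
      using arcs uv(2,3) A(1) B(1) not_both by (auto simp: del_edge_def)
    then show False
      using del[OF uv(1)] bipartitioned_graph.dominator_wins_2_iff_full[OF del_edge n m] A B by blast
  qed
  then have "B_shape G V1 V2 A B" using A B arcs bipartition unfolding B_shape_def by blast
  then show "\<exists>A B. B_shape G V1 V2 A B" by blast
next
  assume "\<exists>A B. B_shape G V1 V2 A B"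
  then obtain A B where A: "A \<subseteq> V1" "card A = 2" and B: "B \<subseteq> V2" "card B = 2"
    and arcs: "\<And>u v. u \<in> V1 \<Longrightarrow> v \<in> V2 \<Longrightarrow> (u, v) \<in> parcs G \<longleftrightarrow> u \<in> A \<or> v \<in> B"
    unfolding B_shape_def by blast
  have "A \<times> V2 \<union> V1 \<times> B \<subseteq> parcs G" using arcs A(1) B(1) by blast
  then have "dominator_wins_from G 2 []" using dominator_wins_2_iff_full[OF n m] A B by blast
  moreover have "\<not> dominator_wins_from G 1 []" using not_dominator_wins_1 n m by simp
  moreover have fails: "\<not> dominator_wins_from (del_edge G u v) 2 []"
    if uv: "u \<in> V1" "v \<in> V2" "u \<in> A \<or> v \<in> B" for u v
  proof
    assume "dominator_wins_from (del_edge G u v) 2 []"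
    then obtain A' B' where A': "A' \<subseteq> V1" "card A' = 2" and B': "B' \<subseteq> V2" "card B' = 2"
      and arcs': "A' \<times> V2 \<union> V1 \<times> B' \<subseteq> parcs (del_edge G u v)"
      unfolding bipartitioned_graph.dominator_wins_2_iff_full[OF del_edge n m] by blast
    have nuv: "u \<notin> A'" "v \<notin> B'" using arcs' uv(1,2) by (auto simp: del_edge_def)
    have sub: "A' \<times> V2 \<union> V1 \<times> B' \<subseteq> parcs G" using arcs' by (auto simp: del_edge_def)
    have fin: "finite A" "finite B" using A(1) B(1) finite_parts finite_subset by blast+
    \<comment> \<open>A vertex of \<open>V1\<close> outside \<open>A\<close> is adjacent to
      \<open>B\<close> only, hence not full as \<open>V2\<close> has a third vertex. So
      \<open>A' = A\<close>, and \<open>u\<close> is outside it.\<close>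
    have "\<not> V2 \<subseteq> B" using card_mono[OF fin(2), of V2] m B(2) by auto
    then have "A' \<subseteq> A" using sub arcs A'(1) by blast
    then have "u \<notin> A" using card_subset_eq[OF fin(1)] A(2) A'(2) nuv(1) by metis
    \<comment> \<open>All neighbours of \<open>u\<close> lie in \<open>B\<close>, so
      \<open>u\<close> itself witnesses that full vertices of \<open>V2\<close> are in
      \<open>B\<close>. This avoids assuming a third vertex in \<open>V1\<close>.\<close>
    then have "B' \<subseteq> B" using sub arcs B'(1) uv(1) by blast
    then have "v \<notin> B" using card_subset_eq[OF fin(2)] B(2) B'(2) nuv(2) by metis
    with uv(3) \<open>u \<notin> A\<close> show False by blast
  qed
  moreover have "\<not> dominator_wins_from (del_edge G u v) 2 []" if uv: "(u, v) \<in> parcs G" for u v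
  proof -
    have eq: "del_edge G u v = del_edge G v u" by (simp add: del_edge_def insert_commute)
    have vu: "(v, u) \<in> parcs G" using uv arcs_symmetric by blast
    from arcs_cross[OF uv] show ?thesis
    proof
      assume "u \<in> V1 \<and> v \<in> V2"
      then show ?thesis using fails arcs uv by blast
    next
      assume "u \<in> V2 \<and> v \<in> V1"
      then show ?thesis unfolding eq using fails arcs vu by blast
    qed
  qed
  ultimately show "gamma_MB'_critical 2 G"
    using gamma_MB'_critical_2_iff[OF pair_finite_verts] by auto
qed

text \<open>
  On four vertices a perfect matching is already enough for Dominator, and a connected graph
  has a further edge, which can be deleted.
\<close>

lemma not_critical_four_vertices:
  assumes conn: "connected (with_proj G)" and n: "card V1 = 2" and m: "card V2 = 2"
  shows "\<not> gamma_MB'_critical 2 G"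
proof
  assume "gamma_MB'_critical 2 G"
  then have C2: "dominator_wins_from G 2 []"
    and del: "\<And>u v. (u, v) \<in> parcs G \<Longrightarrow> \<not> dominator_wins_from (del_edge G u v) 2 []"
    using gamma_MB'_critical_2_iff[OF pair_finite_verts] by auto
  obtain a b where ab: "V1 = {a, b}" "a \<noteq> b" using n by (auto simp: card_2_iff)
  obtain c d where cd: "V2 = {c, d}" "c \<noteq> d" using m by (auto simp: card_2_iff)
  have dist: "distinct [a, b, c, d]" using ab cd disjoint by auto
  have V: "pverts G = {a, b, c, d}" using verts ab cd by auto
  \<comment> \<open>The four variables cover both possible perfect matchings at once.\<close>
  have no_matching: False
    if xz: "(x, z) \<in> parcs G" and yw: "(y, w) \<in> parcs G"
      and x: "x = a \<and> y = b" and z: "z = c \<and> w = d \<or> z = d \<and> w = c" for x y z w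
  proof -
    have V': "pverts G = {x, y, z, w}" and dist': "distinct [x, y, z, w]" using V dist x z by auto
    have "(p, q) \<notin> parcs G" if pq: "p = x \<and> q = w \<or> p = y \<and> q = z" for p q
    proof
      assume "(p, q) \<in> parcs G"
      moreover have "(x, z) \<in> parcs (del_edge G p q)" "(y, w) \<in> parcs (del_edge G p q)"
        using xz yw pq dist' by (auto simp: del_edge_def)
      then have "dominator_wins_from (del_edge G p q) 2 []"
        using dominator_wins_2_of_perfect_matching[OF pair_graph_del_edge[OF pair_graph_axioms]]
          V' dist' by (simp add: del_edge_def)
      ultimately show False using del by blast
    qed
    then have "(x, w) \<notin> parcs G" "(y, z) \<notin> parcs G" "(w, x) \<notin> parcs G" "(z, y) \<notin> parcs G"
      using arcs_symmetric by blast+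
    \<comment> \<open>Without further edges \<open>{x, z}\<close> is closed under adjacency,
      contradicting connectivity.\<close>
    then have "p \<in> {x, z} \<longleftrightarrow> q \<in> {x, z}" if "(p, q) \<in> parcs G" for p q
      using that arcs_cross[OF that] ab cd x z dist' by auto
    then have "{x, z} = pverts G"
      using V' by (intro connected_closed_eq[OF pair_graph_axioms conn]) auto
    with V' dist' show False by auto
  qed
  have nb: "\<exists>q. (p, q) \<in> parcs G" if "p \<in> pverts G" for p
    using neighbour_if_dominator_wins_2[OF C2 that] arcs_symmetric by blast
  \<comment> \<open>Two vertices on each side, none of them isolated, always admit one of the two
    perfect matchings.\<close>
  have "(a, c) \<in> parcs G \<or> (a, d) \<in> parcs G" "(b, c) \<in> parcs G \<or> (b, d) \<in> parcs G"
    "(a, c) \<in> parcs G \<or> (b, c) \<in> parcs G" "(a, d) \<in> parcs G \<or> (b, d) \<in> parcs G"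
    using nb[of a] nb[of b] nb[of c] nb[of d] arcs_cross arcs_symmetric V dist ab cd
    by (auto; blast)+
  then show False using no_matching[of a c b d] no_matching[of a d b c] by blast
qed

end


section \<open>The graphs \<open>B\<^bsub>n,m\<^esub>\<close> for \<open>n, m \<ge> 2\<close>\<close>

text \<open>For \<open>n = 2\<close> the condition \<open>i < 2\<close> always holds, so both
  alternatives of the characterisation are instances of \<open>B_graph\<close>.\<close>

lemma K_graph_eq_B_graph: "K_graph 2 m = B_graph 2 m"
  by (auto simp: K_graph_def B_graph_def)

lemma pair_wf_digraph_B_graph: "pair_wf_digraph (B_graph n m)"
  using pair_graph_B_graph by (intro pair_digraph.pair_wf_digraph) (simp add: pair_graph_def)

text \<open>Numbering each side with \<open>A\<close> and \<open>B\<close> first turns the adjacency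
  rule into \<open>i < 2 \<or> j < 2\<close>.\<close>

lemma B_shape_imp_isomorphic:
  assumes "pair_graph G" "B_shape G V1 V2 A B"
  shows "isomorphic G (B_graph (card V1) (card V2))"
proof -
  interpret bipartitioned_graph G V1 V2
    using assms by (simp add: bipartitioned_graph_def bipartitioned_graph_axioms_def B_shape_def)
  have A: "A \<subseteq> V1" "card A = 2" and B: "B \<subseteq> V2" "card B = 2"
    and adj: "\<And>u v. u \<in> V1 \<Longrightarrow> v \<in> V2 \<Longrightarrow> (u, v) \<in> parcs G \<longleftrightarrow> u \<in> A \<or> v \<in> B"
    using assms(2) by (auto simp: B_shape_def)
  obtain f where f: "bij_betw f V1 {..<card V1}" "\<forall>x \<in> V1. x \<in> A \<longleftrightarrow> f x < 2"
    using ex_numbering[OF finite_parts(1) refl A] by blast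
  obtain g where g: "bij_betw g V2 {..<card V2}" "\<forall>x \<in> V2. x \<in> B \<longleftrightarrow> g x < 2"
    using ex_numbering[OF finite_parts(2) refl B] by blast
  define h where "h x = (if x \<in> V1 then Inl (f x) else Inr (g x))" for x
  have h1: "h x = Inl (f x)" if "x \<in> V1" for x using that by (simp add: h_def)
  have h2: "h x = Inr (g x)" if "x \<in> V2" for x using that disjoint by (auto simp: h_def)
  have fg: "f x < card V1" "g y < card V2" if "x \<in> V1" "y \<in> V2" for x y
    using that f(1) g(1) bij_betwE by blast+
  have "bij_betw (Inl \<circ> f) V1 (Inl ` {..<card V1})" "bij_betw (Inr \<circ> g) V2 (Inr ` {..<card V2})"
    by (rule bij_betw_trans, rule f(1) g(1), simp add: bij_betw_def)+
  then have "bij_betw h V1 (Inl ` {..<card V1})" "bij_betw h V2 (Inr ` {..<card V2})"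
    by (simp_all add: h1 h2 cong: bij_betw_cong)
  then have "bij_betw h (V1 \<union> V2) ({..<card V1} <+> {..<card V2})"
    unfolding Plus_def by (rule bij_betw_combine) auto
  moreover have "(u, v) \<in> parcs G \<longleftrightarrow> (h u, h v) \<in> parcs (B_graph (card V1) (card V2))"
    if uv: "u \<in> V1 \<union> V2" "v \<in> V1 \<union> V2" for u v
  proof -
    have adj': "(v, u) \<in> parcs G \<longleftrightarrow> u \<in> A \<or> v \<in> B" if "u \<in> V1" "v \<in> V2" for u v
      using adj[OF that] arcs_symmetric by blast
    consider "u \<in> V1" "v \<in> V1" | "u \<in> V2" "v \<in> V2" | "u \<in> V1" "v \<in> V2" | "u \<in> V2" "v \<in> V1"
      using uv by blast
    then show ?thesis
    proof cases
      case 1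
      then have "(u, v) \<notin> parcs G" using no_arc by blast
      with 1 show ?thesis by (simp add: h1 B_graph_def)
    next
      case 2
      then have "(u, v) \<notin> parcs G" using no_arc by blast
      with 2 show ?thesis by (simp add: h2 B_graph_def)
    next
      case 3
      then show ?thesis using adj[OF 3] f(2) g(2) fg by (simp add: h1 h2 B_graph_def)
    next
      case 4
      then show ?thesis using adj'[OF 4(2,1)] f(2) g(2) fg by (simp add: h1 h2 B_graph_def)
    qed
  qed
  ultimately show ?thesis
    using isomorphic_iff[OF pair_wf_digraph pair_wf_digraph_B_graph] verts
    by (auto simp: B_graph_def)
qed

lemma isomorphic_imp_B_shape:
  assumes G: "pair_graph G" and iso: "isomorphic G (B_graph n m)" and nm: "2 \<le> n" "2 \<le> m"
  shows "\<exists>V1 V2 A B. B_shape G V1 V2 A B \<and> card V1 = n \<and> card V2 = m"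
proof -
  interpret pair_graph G by (fact G)
  let ?H = "B_graph n m"
  obtain f where f: "bij_betw f (pverts G) (pverts ?H)"
    and adj: "\<And>u v. u \<in> pverts G \<Longrightarrow> v \<in> pverts G \<Longrightarrow> (u, v) \<in> parcs G \<longleftrightarrow> (f u, f v) \<in> parcs ?H"
    using iso isomorphic_iff[OF pair_wf_digraph pair_wf_digraph_B_graph] by blast
  \<comment> \<open>Sides and full vertices of \<open>G\<close> are preimages under
    \<open>f\<close>, which preserve cardinality.\<close>
  let ?P = "\<lambda>S. {v \<in> pverts G. f v \<in> S}"
  have card_P: "card (?P S) = card S" if "S \<subseteq> pverts ?H" for S
  proof -
    have "f ` ?P S = S" using f that by (auto simp: bij_betw_def)
    moreover have "inj_on f (?P S)" using f by (auto simp: bij_betw_def inj_on_def)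
    ultimately show ?thesis using card_image by metis
  qed
  have H: "pverts ?H = Inl ` {..<n} \<union> Inr ` {..<m}" by (simp add: B_graph_def Plus_def)
  have fv: "f v \<in> Inl ` {..<n} \<union> Inr ` {..<m}" if "v \<in> pverts G" for v
    using f that H bij_betwE by blast
  have "bipartition G (?P (Inl ` {..<n})) (?P (Inr ` {..<m}))"
    unfolding bipartition_def
  proof (intro conjI subsetI)
    fix e assume e: "e \<in> parcs G"
    obtain u v where uv: "e = (u, v)" by (cases e)
    then have "u \<in> pverts G" "v \<in> pverts G" using e in_arcsD1 in_arcsD2 by blast+
    moreover from this have "(f u, f v) \<in> parcs ?H" using adj e uv by blast
    ultimately show "e \<in> ?P (Inl ` {..<n}) \<times> ?P (Inr ` {..<m}) \<union> ?P (Inr ` {..<m}) \<times> ?P (Inl ` {..<n})"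
      using uv by (auto simp: B_graph_def)
  qed (use fv in auto)
  moreover have "(u, v) \<in> parcs G \<longleftrightarrow> u \<in> ?P (Inl ` {..<2}) \<or> v \<in> ?P (Inr ` {..<2})"
    if "u \<in> ?P (Inl ` {..<n})" "v \<in> ?P (Inr ` {..<m})" for u v
    using that adj by (auto simp: B_graph_def)
  moreover have "card (?P (Inl ` {..<n})) = n" "card (?P (Inr ` {..<m})) = m"
    "card (?P (Inl ` {..<2})) = 2" "card (?P (Inr ` {..<2})) = 2"
    using nm by (subst card_P; auto simp: H card_image)+
  moreover have "?P (Inl ` {..<2}) \<subseteq> ?P (Inl ` {..<n})" "?P (Inr ` {..<2}) \<subseteq> ?P (Inr ` {..<m})"
    using nm by auto
  ultimately show ?thesis unfolding B_shape_def by blast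
qed

theorem theorem4p7:
  fixes G :: "'a pair_pre_digraph"
  assumes "pair_graph G" and "connected (with_proj G)" and "bipartite G"
  shows "gamma_MB'_critical 2 G \<longleftrightarrow>
    (\<exists>m\<ge>3. isomorphic G (K_graph 2 m)) \<or>
    (\<exists>n\<ge>3. \<exists>m\<ge>3. isomorphic G (B_graph n m))"
proof
  assume crit: "gamma_MB'_critical 2 G"
  obtain V1 V2 where "bipartition G V1 V2" using assms(3) by (auto simp: bipartite_def)
  then interpret bipartitioned_graph G V1 V2
    using assms(1) by (simp add: bipartitioned_graph_def bipartitioned_graph_axioms_def)
  interpret swap: bipartitioned_graph G V2 V1 by (fact swap)
  have "dominator_wins_from G 2 []" "\<not> dominator_wins_from G 1 []"
    using crit gamma_MB'_critical_2_iff[OF pair_finite_verts] by blast+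
  then have n: "2 \<le> card V1" and m: "2 \<le> card V2"
    by (rule two_le_card_part, rule swap.two_le_card_part)
  have "\<not> (card V1 = 2 \<and> card V2 = 2)" using not_critical_four_vertices assms(2) crit by blast
  \<comment> \<open>Some side has at least three vertices; in the second case the sides are
    interchanged, and \<open>card V1\<close> becomes the parameter of
    \<open>K_graph 2\<close>.\<close>
  then consider "3 \<le> card V2" | "3 \<le> card V1" "card V2 = 2" using n m by linarith
  then show "(\<exists>m\<ge>3. isomorphic G (K_graph 2 m)) \<or> (\<exists>n\<ge>3. \<exists>m\<ge>3. isomorphic G (B_graph n m))"
  proof cases
    case 1
    then have "isomorphic G (B_graph (card V1) (card V2))"
      using crit critical_iff_B_shape[OF n] B_shape_imp_isomorphic[OF assms(1)] by blast
    moreover have "card V1 = 2 \<or> 3 \<le> card V1" using n by linarith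
    ultimately show ?thesis using 1 by (auto simp: K_graph_eq_B_graph)
  next
    case 2
    then have "isomorphic G (B_graph (card V2) (card V1))"
      using crit swap.critical_iff_B_shape[OF m] B_shape_imp_isomorphic[OF assms(1)] by blast
    with 2 show ?thesis by (auto simp: K_graph_eq_B_graph)
  qed
next
  assume "(\<exists>m\<ge>3. isomorphic G (K_graph 2 m)) \<or> (\<exists>n\<ge>3. \<exists>m\<ge>3. isomorphic G (B_graph n m))"
  then obtain n m where nm: "2 \<le> n" "3 \<le> m" and iso: "isomorphic G (B_graph n m)"
  proof (elim disjE exE conjE)
    fix m :: nat
    assume "3 \<le> m" "isomorphic G (K_graph 2 m)"
    then show thesis using that[of 2 m] by (simp add: K_graph_eq_B_graph)
  next
    fix n m :: nat
    assume "3 \<le> n" "3 \<le> m" "isomorphic G (B_graph n m)"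
    then show thesis using that[of n m] by simp
  qed
  then obtain V1 V2 A B where shape: "B_shape G V1 V2 A B" and "card V1 = n" "card V2 = m"
    using isomorphic_imp_B_shape[OF assms(1) iso] by auto
  moreover have "bipartitioned_graph G V1 V2"
    using shape assms(1)
    by (simp add: bipartitioned_graph_def bipartitioned_graph_axioms_def B_shape_def)
  ultimately show "gamma_MB'_critical 2 G"
    using bipartitioned_graph.critical_iff_B_shape nm by blast
qed

end
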